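(* Let $f\colon\mathbb{N}^*\to\mathbb{N}^*$ be an increasing (i.e. non-decreasing) function with $f(n)\ge\log_2n$ for all $n\in\mathbb{N}^*$, and let $f^\ast$ be its conjugate function. The following are equivalent: (1) $T^{f(n)}(n)\in\{1,2\}$ for every $n\in\mathbb{N}^*$. (2) For every $n_1\le n_2$ in $\mathbb{N}^*$, $$\left\langle \mathrm{id}_{\le f^\ast(n_1)}(p_{n_1}),\ \mathrm{id}_{\le f^\ast(n_2)}(p_{n_2})\right\rangle=(-1)^{n_2-n_1}f^\ast(n_1).$$
   Context: $\mathbb{N}^*=\{1,2,3,\dots\}$. The Collatz map $T\colon\mathbb{N}^*\to\mathbb{N}^*$ is $T(n)=n/2$ for $n$ even and $T(n)=(3n+1)/2$ for $n$ odd. For $k\in\mathbb{N}^*$, $p_k=\left((-1)^{T^k(\upsilon)}\right)_{\upsilon=1}^{2^k}$. For an integer $0\le r\le2^k$, $\mathrm{id}_{\le r}(p_k)=\left((-1)^{T^k(1)},\dots,(-1)^{T^k(r)},0,\dots,0\right)$ keeps the first $r$ coordinates and replaces the others by $0$. $\langle\cdot,\cdot\rangle$ is the standard inner product, vectors of different lengths being extended by zeros. Conjugate function: such an $f$ is a step function determined by two strictly increasing sequences $1=a_1<a_2<\cdots$ and $b_1<b_2<\cdots$ with $f(n)=b_i$ for $a_i\le n<a_{i+1}$; then $f^\ast(n)=a_{i+1}-1$ for $b_i\le n<b_{i+1}$, and $f^\ast(n)=0$ for $n<b_1$. Equivalently, $f^\ast(n)=\max\{m\in\mathbb{N}^*\mid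 f(m)\le n\}$ (with $\max\emptyset=0$); note $f^\ast(n)\le2^n$. *)

theory Defs
  imports Complex_Main "Jordan_Normal_Form.Matrix"
begin

text \<open>The positive integers are the type \<^typ>\<open>nat\<close> with explicit guards; the values of the
  functions below at \<open>0\<close> play no role.\<close>

definition collatz :: "nat \<Rightarrow> nat" where
  "collatz n = (if even n then n div 2 else (3 * n + 1) div 2)"

text \<open>Library vectors are indexed from \<open>0\<close>, so entry \<open>i\<close> of \<open>parity_vec k\<close> is
  coordinate \<open>i + 1\<close> of $p_k$.\<close>

definition parity_vec :: "nat \<Rightarrow> real vec" where
  "parity_vec k = vec (2 ^ k) (\<lambda>i. (- 1) ^ ((collatz ^^ k) (i + 1)))"

definition id_le :: "nat \<Rightarrow> real vec \<Rightarrow> real vec" where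
  "id_le r v = vec (dim_vec v) (\<lambda>i. if i < r then v $ i else 0)"

definition zero_extend :: "nat \<Rightarrow> real vec \<Rightarrow> real vec" where
  "zero_extend n v = vec n (\<lambda>i. if i < dim_vec v then v $ i else 0)"

definition inner_ext :: "real vec \<Rightarrow> real vec \<Rightarrow> real" where
  "inner_ext u v =
    (let n = max (dim_vec u) (dim_vec v) in zero_extend n u \<bullet> zero_extend n v)"

text \<open>The maximum is meaningful when the set is finite, which holds for every \<open>n\<close> as soon as
  $f(m) \ge \log_2 m$ for all \<open>m\<close>.\<close>

definition conjugate_fun :: "(nat \<Rightarrow> nat) \<Rightarrow> nat \<Rightarrow> nat" where
  "conjugate_fun f n =
    (let S = {m. 1 \<le> m \<and> f m \<le> n} in if S = {} then 0 else Max S)"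

text \<open>Agreement with the description of the conjugate of a step function by its jump points
  \<open>a\<close> and values \<open>b\<close> (both indexed from \<open>0\<close> here).\<close>

lemma conjugate_fun_step:
  fixes f a b :: "nat \<Rightarrow> nat"
  assumes a: "strict_mono a" "a 0 = 1" and b: "strict_mono b"
    and f: "\<And>i n. a i \<le> n \<Longrightarrow> n < a (Suc i) \<Longrightarrow> f n = b i"
  shows "n < b 0 \<Longrightarrow> conjugate_fun f n = 0"
    and "b i \<le> n \<Longrightarrow> n < b (Suc i) \<Longrightarrow> conjugate_fun f n = a (Suc i) - 1"
proof -
  have ex: "\<exists>j. a j \<le> m \<and> m < a (Suc j)" if "1 \<le> m" for m
  proof -
    define j where "j = (LEAST j. m < a (Suc j))"
    have "m < a (Suc m)"
      using strict_mono_imp_increasing[OF a(1), of "Suc m"] by simp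
    then have j: "m < a (Suc j)"
      unfolding j_def by (rule LeastI)
    have "a j \<le> m"
    proof (cases j)
      case 0
      then show ?thesis using that a(2) by simp
    next
      case (Suc l)
      then have "\<not> m < a (Suc l)"
        unfolding j_def by (intro not_less_Least) simp
      then show ?thesis using Suc by simp
    qed
    with j show ?thesis by blast
  qed
  {
    assume n: "n < b 0"
    have "\<not> f m \<le> n" if "1 \<le> m" for m
    proof -
      obtain j where "a j \<le> m" "m < a (Suc j)" using ex[OF \<open>1 \<le> m\<close>] by blast
      then have "f m = b j" by (rule f)
      moreover have "b 0 \<le> b j" using b by (simp add: strict_mono_less_eq)
      ultimately show ?thesis using n by simp
    qed
    then show "conjugate_fun f n = 0" by (auto simp: conjugate_fun_def Let_def)
  }
  assume n: "b i \<le> n" "n < b (Suc i)"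
  have a1: "1 \<le> a j" for j
    using a by (metis strict_mono_less_eq zero_le)
  have "f m \<le> n \<longleftrightarrow> m \<le> a (Suc i) - 1" if m: "1 \<le> m" for m
  proof -
    obtain j where j: "a j \<le> m" "m < a (Suc j)" using ex[OF m] by blast
    have fm: "f m = b j" using j by (rule f)
    show ?thesis
    proof
      assume "f m \<le> n"
      then have "b j < b (Suc i)" using fm n by simp
      then have "j \<le> i" using b by (simp add: strict_mono_less)
      then have "a (Suc j) \<le> a (Suc i)" using a(1) by (simp add: strict_mono_less_eq)
      then show "m \<le> a (Suc i) - 1" using j by simp
    next
      assume "m \<le> a (Suc i) - 1"
      then have "a j < a (Suc i)" using j m a1[of "Suc i"] by linarith
      then have "j \<le> i" using a(1) by (simp add: strict_mono_less)
      then have "b j \<le> b i" using b by (simp add: strict_mono_less_eq)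
      then show "f m \<le> n" using fm n by simp
    qed
  qed
  then have S: "{m. 1 \<le> m \<and> f m \<le> n} = {1..a (Suc i) - 1}" by auto
  have "a 0 < a (Suc i)" using a(1) by (simp add: strict_mono_less)
  then have "1 \<le> a (Suc i) - 1" using a(2) by simp
  moreover from this have "Max {1..a (Suc i) - 1} = a (Suc i) - 1"
    by (intro Max_eqI) auto
  ultimately show "conjugate_fun f n = a (Suc i) - 1"
    unfolding conjugate_fun_def S by (simp add: Let_def)
qed

end

theory Submission
  imports Defs
begin

text \<open>
  Since \<open>f\<close> is monotone, a positive \<open>v\<close> is at most \<open>conjugate_fun f n\<close> exactly when
  \<open>f v \<le> n\<close> (\<open>le_conjugate_fun_iff\<close>), and \<open>f v \<ge> log 2 v\<close> makes \<open>conjugate_fun f n\<close> at most the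
  length \<open>2 ^ n\<close> of \<open>parity_vec n\<close>, so the truncation never runs past the end of the vector.
  The inner product in the theorem is therefore a sum of \<open>conjugate_fun f n1\<close> signs, one for each
  positive \<open>v\<close> with \<open>f v \<le> n1\<close>: the sign is \<open>+1\<close> if \<open>v\<close> has iterates of equal parity at
  the times \<open>n1\<close> and \<open>n2\<close>, and \<open>-1\<close> otherwise.  The prescribed value has the largest possible
  modulus, so it is attained only if all these signs equal \<open>(- 1) ^ (n2 - n1)\<close>
  (\<open>sum_signs_extremal_iff\<close>).  Letting \<open>n1\<close> and \<open>n2\<close> vary, the second condition says that from
  time \<open>f v\<close> on the orbit of every \<open>v\<close> alternates between even and odd numbers.

  It remains to see that a positive \<open>x\<close> has an orbit of alternating parity if and only if
  \<open>x\<close> is \<open>1\<close> or \<open>2\<close> (\<open>alternating_orbit_iff\<close>).  The two-cycle of \<open>1\<close> and \<open>2\<close> alternates.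
  Conversely, two steps of an alternating orbit send an odd \<open>x\<close> to \<open>(3 * x + 1) / 4\<close>, which is less
  than \<open>x\<close> unless \<open>x = 1\<close> and equals \<open>1\<close> only for \<open>x = 1\<close>, so descent applies.
\<close>

lemma collatz_pos: "1 \<le> x \<Longrightarrow> 1 \<le> collatz x"
  by (auto simp: collatz_def elim!: evenE)

lemma funpow_collatz_pos: "1 \<le> x \<Longrightarrow> 1 \<le> (collatz ^^ k) x"
  by (induction k) (auto dest: collatz_pos simp del: One_nat_def)

lemma funpow_collatz_in_cycle:
  assumes "x \<in> {1, 2}"
  shows "(collatz ^^ k) x \<in> {1, 2} \<and> (even ((collatz ^^ k) x) \<longleftrightarrow> even (x + k))"
  using assms by (induction k) (auto simp: collatz_def)

lemma odd_alternating_orbit_eq_1: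
  assumes "1 \<le> x" "odd x" and alt: "\<forall>k. even ((collatz ^^ k) x) \<longleftrightarrow> even (x + k)"
  shows "x = 1"
  using assms
proof (induction x rule: less_induct)
  case (less x)
  define y where "y = (collatz ^^ 2) x"
  have step: "(collatz ^^ k) y = (collatz ^^ (k + 2)) x" for k
    unfolding y_def by (simp only: funpow_add comp_apply)
  have "even (collatz x)" "odd y"
    using less.prems(2) less.prems(3)[rule_format, of 1] less.prems(3)[rule_format, of 2]
    by (simp_all add: y_def)
  moreover have "y = collatz (collatz x)" by (simp add: y_def numeral_2_eq_2)
  ultimately have "2 * y = collatz x" by (simp add: collatz_def)
  moreover have "2 * collatz x = 3 * x + 1" using less.prems(2) by (simp add: collatz_def)
  ultimately have y: "4 * y = 3 * x + 1" by linarith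
  have alt_y: "\<forall>k. even ((collatz ^^ k) y) \<longleftrightarrow> even (y + k)"
    using less.prems(2,3) \<open>odd y\<close> by (simp add: step del: funpow.simps)
  show ?case
  proof (rule ccontr)
    assume "x \<noteq> 1"
    then have "y < x" "1 \<le> y" using y less.prems(1) by linarith+
    then have "y = 1" using less.IH \<open>odd y\<close> alt_y by blast
    then show False using y \<open>x \<noteq> 1\<close> by simp
  qed
qed

text \<open>An even start reduces to an odd one, as halving it must give the odd number \<open>1\<close>.\<close>

lemma alternating_orbit_iff:
  assumes "1 \<le> x"
  shows "(\<forall>k. even ((collatz ^^ k) x) \<longleftrightarrow> even (x + k)) \<longleftrightarrow> x \<in> {1, 2}"
proof
  assume alt: "\<forall>k. even ((collatz ^^ k) x) \<longleftrightarrow> even (x + k)"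
  show "x \<in> {1, 2}"
  proof (cases "even x")
    case False
    then show ?thesis using odd_alternating_orbit_eq_1[OF assms] alt by blast
  next
    case True
    have "odd (collatz x)" using alt[rule_format, of 1] True by simp
    moreover have "\<forall>k. even ((collatz ^^ k) (collatz x)) \<longleftrightarrow> even (collatz x + k)"
    proof
      fix k
      show "even ((collatz ^^ k) (collatz x)) \<longleftrightarrow> even (collatz x + k)"
        using alt[rule_format, of "Suc k"] True \<open>odd (collatz x)\<close>
        by (simp add: funpow_swap1)
    qed
    ultimately have "collatz x = 1"
      using odd_alternating_orbit_eq_1 collatz_pos[OF assms] by blast
    then show ?thesis using True by (auto simp: collatz_def elim!: evenE)
  qed
next
  assume "x \<in> {1, 2}"
  then show "\<forall>k. even ((collatz ^^ k) x) \<longleftrightarrow> even (x + k)"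
    using funpow_collatz_in_cycle by blast
qed

lemma le_conjugate_fun_iff:
  assumes mono: "mono_on {1..} f" and fin: "finite {m. 1 \<le> m \<and> f m \<le> n}" and "1 \<le> m"
  shows "m \<le> conjugate_fun f n \<longleftrightarrow> f m \<le> n"
proof
  assume "f m \<le> n"
  then show "m \<le> conjugate_fun f n"
    using fin \<open>1 \<le> m\<close> by (auto simp: conjugate_fun_def Let_def intro!: Max_ge)
next
  assume m: "m \<le> conjugate_fun f n"
  let ?S = "{m. 1 \<le> m \<and> f m \<le> n}"
  have "?S \<noteq> {}" using m \<open>1 \<le> m\<close> unfolding conjugate_fun_def Let_def by (auto split: if_splits)
  then have "conjugate_fun f n = Max ?S" "Max ?S \<in> ?S"
    using fin Max_in[of ?S] by (simp_all add: conjugate_fun_def Let_def)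
  then have "f (conjugate_fun f n) \<le> n" "1 \<le> conjugate_fun f n" by auto
  moreover from this have "f m \<le> f (conjugate_fun f n)"
    using mono_onD[OF mono, of m "conjugate_fun f n"] m \<open>1 \<le> m\<close> by simp
  ultimately show "f m \<le> n" by linarith
qed

lemma le_power_if_log_le:
  assumes "1 \<le> m" "log 2 (real m) \<le> real n"
  shows "m \<le> 2 ^ n"
proof -
  have "real m \<le> 2 powr real n" using assms by (simp add: log_le_iff)
  then have "real m \<le> real (2 ^ n)" by (simp add: powr_realpow)
  then show ?thesis by linarith
qed

lemma inner_ext_id_le_parity_vec:
  assumes "r1 \<le> r2" "r1 \<le> 2 ^ n1" "n1 \<le> n2"
  shows "inner_ext (id_le r1 (parity_vec n1)) (id_le r2 (parity_vec n2))
    = (\<Sum>v = 1..r1. (- 1) ^ ((collatz ^^ n1) v + (collatz ^^ n2) v))"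
proof -
  have pow: "(2::nat) ^ n1 \<le> 2 ^ n2" using \<open>n1 \<le> n2\<close> by simp
  then have "r1 \<le> 2 ^ n2" using \<open>r1 \<le> 2 ^ n1\<close> by linarith
  let ?g = "\<lambda>v. (- 1 :: real) ^ ((collatz ^^ n1) v + (collatz ^^ n2) v)"
  have "inner_ext (id_le r1 (parity_vec n1)) (id_le r2 (parity_vec n2))
    = (\<Sum>i\<in>{0..<2 ^ n2}. if i < r1 then ?g (i + 1) else 0)"
    unfolding inner_ext_def Let_def scalar_prod_def
    using assms pow
    by (intro sum.cong)
       (auto simp: zero_extend_def id_le_def parity_vec_def max_def power_add)
  also have "\<dots> = (\<Sum>i\<in>{0..<r1}. ?g (i + 1))"
    using \<open>r1 \<le> 2 ^ n2\<close> by (intro sum.mono_neutral_cong_right) auto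
  also have "\<dots> = (\<Sum>v = 1..r1. ?g v)"
    by (rule sum.reindex_bij_witness[of _ "\<lambda>v. v - 1" "\<lambda>i. i + 1"]) auto
  finally show ?thesis .
qed

text \<open>After multiplication by \<open>(- 1) ^ d\<close>, the difference of the two sides is a sum of the
  nonnegative terms \<open>1 - (- 1) ^ (g i + d)\<close>, so it vanishes only if every term does.\<close>

lemma sum_signs_extremal_iff:
  fixes g :: "'a \<Rightarrow> nat"
  assumes "finite A"
  shows "(\<Sum>i\<in>A. (- 1) ^ g i) = (- 1) ^ d * real (card A) \<longleftrightarrow> (\<forall>i\<in>A. even (g i + d))"
proof -
  have "(\<Sum>i\<in>A. 1 - (- 1 :: real) ^ (g i + d))
      = real (card A) - (- 1) ^ d * (\<Sum>i\<in>A. (- 1) ^ g i)"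
    by (simp add: sum_subtractf sum_distrib_left power_add mult.commute)
  then have "(\<Sum>i\<in>A. (- 1) ^ g i) = (- 1) ^ d * real (card A)
      \<longleftrightarrow> (\<Sum>i\<in>A. 1 - (- 1 :: real) ^ (g i + d)) = 0"
    by (cases "even d") auto
  also have "\<dots> \<longleftrightarrow> (\<forall>i\<in>A. 1 - (- 1 :: real) ^ (g i + d) = 0)"
    using assms by (intro sum_nonneg_eq_0_iff) (auto simp: minus_one_power_iff)
  also have "\<dots> \<longleftrightarrow> (\<forall>i\<in>A. even (g i + d))"
    by (auto simp: minus_one_power_iff)
  finally show ?thesis .
qed

theorem theorem10p1:
  fixes f :: "nat \<Rightarrow> nat"
  assumes f_pos: "\<forall>n\<ge>1. 1 \<le> f n"
    and f_mono: "mono_on {1..} f"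
    and f_log: "\<forall>n\<ge>1. real (f n) \<ge> log 2 (real n)"
  shows "(\<forall>n\<ge>1. (collatz ^^ f n) n \<in> {1, 2}) \<longleftrightarrow>
    (\<forall>n1 n2. 1 \<le> n1 \<and> n1 \<le> n2 \<longrightarrow>
      inner_ext (id_le (conjugate_fun f n1) (parity_vec n1))
                (id_le (conjugate_fun f n2) (parity_vec n2))
      = (- 1) ^ (n2 - n1) * real (conjugate_fun f n1))"
proof -
  let ?c = "conjugate_fun f"
  have bound: "m \<le> 2 ^ n" if "1 \<le> m" "f m \<le> n" for m n
    using that f_log by (intro le_power_if_log_le) (auto intro: order_trans)
  have fin: "finite {m. 1 \<le> m \<and> f m \<le> n}" for n
    by (rule finite_subset[of _ "{..2 ^ n}"]) (auto intro: bound)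
  have c_iff: "m \<le> ?c n \<longleftrightarrow> f m \<le> n" if "1 \<le> m" for m n
    using le_conjugate_fun_iff[OF f_mono fin that] .
  have c_le: "?c n \<le> 2 ^ n" for n
    using c_iff[of "?c n" n] bound[of "?c n" n] by (cases "?c n = 0") auto
  have c_mono: "?c n1 \<le> ?c n2" if "n1 \<le> n2" for n1 n2
    using c_iff[of "?c n1" n1] c_iff[of "?c n1" n2] that by (cases "?c n1 = 0") auto
  let ?alt = "\<lambda>v n1 n2. even ((collatz ^^ n1) v + (collatz ^^ n2) v + (n2 - n1))"
  have inner_iff: "inner_ext (id_le (?c n1) (parity_vec n1)) (id_le (?c n2) (parity_vec n2))
        = (- 1) ^ (n2 - n1) * real (?c n1) \<longleftrightarrow> (\<forall>v\<ge>1. f v \<le> n1 \<longrightarrow> ?alt v n1 n2)"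
    if "n1 \<le> n2" for n1 n2
  proof -
    have "inner_ext (id_le (?c n1) (parity_vec n1)) (id_le (?c n2) (parity_vec n2))
        = (- 1) ^ (n2 - n1) * real (?c n1) \<longleftrightarrow> (\<forall>v\<in>{1..?c n1}. ?alt v n1 n2)"
      unfolding inner_ext_id_le_parity_vec[OF c_mono[OF that] c_le that]
      using sum_signs_extremal_iff[of "{1..?c n1}"] by simp
    also have "\<dots> \<longleftrightarrow> (\<forall>v\<ge>1. f v \<le> n1 \<longrightarrow> ?alt v n1 n2)"
      by (metis atLeastAtMost_iff c_iff)
    finally show ?thesis .
  qed
  have shift: "(collatz ^^ (m + k)) v = (collatz ^^ k) ((collatz ^^ m) v)" for m k v
    by (simp only: add.commute[of m k] funpow_add comp_apply)
  show ?thesis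
  proof (intro iffI allI impI)
    fix n1 n2 :: nat
    assume reach: "\<forall>n\<ge>1. (collatz ^^ f n) n \<in> {1, 2}" and n: "1 \<le> n1 \<and> n1 \<le> n2"
    have "?alt v n1 n2" if v: "1 \<le> v" "f v \<le> n1" for v
    proof -
      have "(collatz ^^ n1) v = (collatz ^^ (n1 - f v)) ((collatz ^^ f v) v)"
        using shift[of "f v" "n1 - f v" v] v by simp
      then have "(collatz ^^ n1) v \<in> {1, 2}"
        using funpow_collatz_in_cycle reach v(1) by metis
      moreover have "(collatz ^^ n2) v = (collatz ^^ (n2 - n1)) ((collatz ^^ n1) v)"
        using shift[of n1 "n2 - n1" v] n by simp
      ultimately have "even ((collatz ^^ n2) v) \<longleftrightarrow> even ((collatz ^^ n1) v + (n2 - n1))"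
        using funpow_collatz_in_cycle by metis
      then show ?thesis by auto
    qed
    then show "inner_ext (id_le (?c n1) (parity_vec n1)) (id_le (?c n2) (parity_vec n2))
        = (- 1) ^ (n2 - n1) * real (?c n1)"
      using inner_iff n by blast
  next
    fix v :: nat
    assume inner: "\<forall>n1 n2. 1 \<le> n1 \<and> n1 \<le> n2 \<longrightarrow>
      inner_ext (id_le (?c n1) (parity_vec n1)) (id_le (?c n2) (parity_vec n2))
        = (- 1) ^ (n2 - n1) * real (?c n1)" and v: "1 \<le> v"
    let ?x = "(collatz ^^ f v) v"
    have "even ((collatz ^^ k) ?x) \<longleftrightarrow> even (?x + k)" for k
    proof -
      \<comment> \<open>The earliest time at which \<open>v\<close> contributes to the inner product is \<open>f v\<close>.\<close>
      have "?alt v (f v) (f v + k)"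
        using inner inner_iff[of "f v" "f v + k"] f_pos v by simp
      then show ?thesis by (auto simp: shift)
    qed
    then show "?x \<in> {1, 2}"
      using alternating_orbit_iff[OF funpow_collatz_pos[OF v]] by blast
  qed
qed

end
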